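(* Let $n\ge 1$ be an integer, $N=n(n-1)/2$, and let $P\subset\mathbb{R}^N$ be a polytope whose normal fan is the Gelfand-Zetlin fan $\Sigma_{\mathrm{GZ}}$. Then there exist $\lambda=(\lambda_1\le\cdots\le\lambda_n)\in\mathbb{R}^n$ and $c\in\mathbb{R}^N$ such that $P=c+\Delta_\lambda$. Moreover, if $P$ is a lattice polytope (all vertices in $\mathbb{Z}^N$), then $\lambda$ can be taken to be a dominant weight (i.e. $\lambda\in\mathbb{Z}^n$) and $c\in\mathbb{Z}^N$.
   Context: For an increasing sequence of real numbers $\lambda=(\lambda_1\le\cdots\le\lambda_n)$, the Gelfand-Zetlin polytope $\Delta_\lambda\subset\mathbb{R}^N$ is the set of $(x_{ij})_{1\le i\le n-1,\,1\le j\le n-i}$ with $x_{(i-1)j}\le x_{ij}\le x_{(i-1)(j+1)}$ for all $1\le i\le n-1$, $1\le j\le n-i$, where $x_{0j}:=\lambda_j$. Dominant weights are the increasing integer sequences $\lambda_1\le\cdots\le\lambda_n$; regular means $\lambda_1<\cdots<\lambda_n$. The normal fan of a polytope $\Delta$ is $\{\sigma_F: F\text{ a face of }\Delta\}$, where $\sigma_F$ is the dual cone of the cone of $\Delta$ at the face $F$. The normal fan of $\Delta_\lambda$ is the same for all regular dominant $\lambda$; this common fan is called the Gelfand-Zetlin fan $\Sigma_{\mathrm{GZ}}$. *)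

theory Defs
  imports "HOL-Analysis.Analysis" "HOL-Analysis.Finite_Function_Topology"
begin

text \<open>
  For a finite index set \<open>I\<close>, the space \<open>\<real>\<^sup>I\<close> is the set of finitely supported functions
  whose support lies in \<open>I\<close>, viewed inside the real vector space \<open>'i \<Rightarrow>\<^sub>0 real\<close>. (A Euclidean
  type is not used for it because its dimension would be positive, excluding \<open>n = 1\<close> below.)
  Dual spaces are identified with \<open>\<real>\<^sup>I\<close> through the standard inner product.
\<close>

definition coord_space :: "'i set \<Rightarrow> ('i \<Rightarrow>\<^sub>0 real) set" where
  "coord_space I = {x. Poly_Mapping.keys x \<subseteq> I}"

definition dot :: "'i set \<Rightarrow> ('i \<Rightarrow>\<^sub>0 real) \<Rightarrow> ('i \<Rightarrow>\<^sub>0 real) \<Rightarrow> real" where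
  "dot I u v = (\<Sum>k\<in>I. Poly_Mapping.lookup u k * Poly_Mapping.lookup v k)"

definition cone_at_face :: "'a::real_vector set \<Rightarrow> 'a set \<Rightarrow> 'a set" where
  "cone_at_face P F = cone hull {x - f | x f. x \<in> P \<and> f \<in> F}"

definition dual_cone :: "'i set \<Rightarrow> ('i \<Rightarrow>\<^sub>0 real) set \<Rightarrow> ('i \<Rightarrow>\<^sub>0 real) set" where
  "dual_cone I C = {u \<in> coord_space I. \<forall>v\<in>C. dot I u v \<ge> 0}"

text \<open>The library's \<open>face_of\<close> also admits the empty face, which has no normal cone.\<close>

definition normal_fan :: "'i set \<Rightarrow> ('i \<Rightarrow>\<^sub>0 real) set \<Rightarrow> ('i \<Rightarrow>\<^sub>0 real) set set" where
  "normal_fan I P = {dual_cone I (cone_at_face P F) | F. F face_of P \<and> F \<noteq> {}}"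

definition lattice_points :: "('i \<Rightarrow>\<^sub>0 real) set" where
  "lattice_points = {x. \<forall>k. Poly_Mapping.lookup x k \<in> \<int>}"

definition lattice_polytope :: "('i \<Rightarrow>\<^sub>0 real) set \<Rightarrow> bool" where
  "lattice_polytope P \<longleftrightarrow> polytope P \<and> (\<forall>v. v extreme_point_of P \<longrightarrow> v \<in> lattice_points)"

text \<open>
  A sequence \<open>\<lambda>\<^sub>1, \<dots>, \<lambda>\<^sub>n\<close> is a function on \<open>nat\<close>; only its values on \<open>{1..n}\<close> matter.
\<close>

definition increasing_seq :: "nat \<Rightarrow> (nat \<Rightarrow> real) \<Rightarrow> bool" where
  "increasing_seq n lam \<longleftrightarrow> mono_on {1..n} lam"

definition dominant_weight :: "nat \<Rightarrow> (nat \<Rightarrow> real) \<Rightarrow> bool" where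
  "dominant_weight n lam \<longleftrightarrow> increasing_seq n lam \<and> (\<forall>j\<in>{1..n}. lam j \<in> \<int>)"

definition regular_seq :: "nat \<Rightarrow> (nat \<Rightarrow> real) \<Rightarrow> bool" where
  "regular_seq n lam \<longleftrightarrow> strict_mono_on {1..n} lam"

definition gz_index :: "nat \<Rightarrow> (nat \<times> nat) set" where
  "gz_index n = {(i, j). 1 \<le> i \<and> i \<le> n - 1 \<and> 1 \<le> j \<and> j \<le> n - i}"

definition gz_entry :: "(nat \<Rightarrow> real) \<Rightarrow> (nat \<times> nat \<Rightarrow>\<^sub>0 real) \<Rightarrow> nat \<Rightarrow> nat \<Rightarrow> real" where
  "gz_entry lam x i j = (if i = 0 then lam j else Poly_Mapping.lookup x (i, j))"

definition gz_polytope :: "nat \<Rightarrow> (nat \<Rightarrow> real) \<Rightarrow> (nat \<times> nat \<Rightarrow>\<^sub>0 real) set" where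
  "gz_polytope n lam = {x \<in> coord_space (gz_index n). \<forall>(i, j)\<in>gz_index n.
     gz_entry lam x (i - 1) j \<le> gz_entry lam x i j \<and>
     gz_entry lam x i j \<le> gz_entry lam x (i - 1) (j + 1)}"

text \<open>
  The Gelfand-Zetlin fan, by means of the regular dominant weight \<open>\<lambda> = (1, \<dots>, n)\<close>. By the lemma
  \<open>normal_fan_gz_polytope\<close> below, every other regular \<open>\<lambda>\<close> gives the same fan.
\<close>

definition gz_fan :: "nat \<Rightarrow> (nat \<times> nat \<Rightarrow>\<^sub>0 real) set set" where
  "gz_fan n = normal_fan (gz_index n) (gz_polytope n real)"

lemma gz_index_eq: "gz_index n = Sigma {1..n-1} (\<lambda>i. {1..n-i})"
  by (auto simp: gz_index_def)

lemma finite_gz_index: "finite (gz_index n)"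
  by (simp add: gz_index_eq)

lemma card_gz_index: "card (gz_index n) = n * (n - 1) div 2"
proof -
  have "card (gz_index n) = (\<Sum>i=1..n-1. n - i)"
    by (simp add: gz_index_eq)
  also have "\<dots> = (\<Sum>i=1..n-1. i)"
    by (rule sum.reindex_bij_witness[where i="\<lambda>i. n - i" and j="\<lambda>i. n - i"]) auto
  also have "\<dots> = (n - 1) * (n - 1 + 1) div 2"
    using gauss_sum_from_Suc_0[of "n - 1", where ?'a=nat] by simp
  also have "\<dots> = n * (n - 1) div 2"
    by (cases n) (auto simp: mult.commute)
  finally show ?thesis .
qed

text \<open>The slack of the lower and upper inequality at \<open>(i, j)\<close>, and its linear part.\<close>

definition gz_slack :: "(nat \<Rightarrow> real) \<Rightarrow> bool \<times> nat \<times> nat \<Rightarrow> (nat \<times> nat \<Rightarrow>\<^sub>0 real) \<Rightarrow> real" where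
  "gz_slack lam = (\<lambda>(b, i, j) x.
     if b then gz_entry lam x i j - gz_entry lam x (i - 1) j
     else gz_entry lam x (i - 1) (j + 1) - gz_entry lam x i j)"

definition gz_active :: "nat \<Rightarrow> (nat \<Rightarrow> real) \<Rightarrow> (nat \<times> nat \<Rightarrow>\<^sub>0 real) \<Rightarrow> (bool \<times> nat \<times> nat) set" where
  "gz_active n lam x = {k \<in> UNIV \<times> gz_index n. gz_slack lam k x = 0}"

definition gz_active_cone :: "nat \<Rightarrow> (bool \<times> nat \<times> nat) set \<Rightarrow> (nat \<times> nat \<Rightarrow>\<^sub>0 real) set" where
  "gz_active_cone n A = dual_cone (gz_index n)
     {v \<in> coord_space (gz_index n). \<forall>k\<in>A. gz_slack (\<lambda>_. 0) k v \<ge> 0}"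

lemma lookup_scaleR: "Poly_Mapping.lookup (c *\<^sub>R x) k = c * Poly_Mapping.lookup (x :: 'i \<Rightarrow>\<^sub>0 real) k"
proof -
  have "{i. c * Poly_Mapping.lookup x i \<noteq> 0} \<subseteq> Poly_Mapping.keys x"
    by (auto simp: in_keys_iff)
  then have "finite {i. c * Poly_Mapping.lookup x i \<noteq> 0}"
    using finite_keys finite_subset by blast
  then show ?thesis
    by (simp add: scaleR_poly_mapping_def)
qed

lemma coord_space_iff: "x \<in> coord_space I \<longleftrightarrow> (\<forall>k. k \<notin> I \<longrightarrow> Poly_Mapping.lookup x k = 0)"
  by (auto simp: coord_space_def in_keys_iff)

lemma gz_slack_add: "gz_slack lam k (x + v) = gz_slack lam k x + gz_slack (\<lambda>_. 0) k v"
  by (cases k) (auto simp: gz_slack_def gz_entry_def lookup_add)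

lemma gz_slack_diff: "gz_slack (\<lambda>_. 0) k (x - y) = gz_slack lam k x - gz_slack lam k y"
  by (cases k) (auto simp: gz_slack_def gz_entry_def lookup_minus)

lemma gz_slack_scaleR: "gz_slack (\<lambda>_. 0) k (c *\<^sub>R v) = c * gz_slack (\<lambda>_. 0) k v"
  by (cases k) (auto simp: gz_slack_def gz_entry_def lookup_scaleR algebra_simps)

lemma gz_slack_convex:
  "gz_slack lam k ((1 - t) *\<^sub>R x + t *\<^sub>R y) = (1 - t) * gz_slack lam k x + t * gz_slack lam k y"
proof -
  have "(1 - t) *\<^sub>R x + t *\<^sub>R y = x + t *\<^sub>R (y - x)"
    by (simp add: algebra_simps)
  then show ?thesis
    by (simp only: gz_slack_add gz_slack_scaleR gz_slack_diff[where lam=lam]) (simp add: algebra_simps)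
qed

lemma gz_polytope_iff: "x \<in> gz_polytope n lam \<longleftrightarrow>
    x \<in> coord_space (gz_index n) \<and> (\<forall>k\<in>UNIV \<times> gz_index n. gz_slack lam k x \<ge> 0)"
  by (auto simp: gz_polytope_def gz_slack_def split: prod.splits)

lemma convex_gz_polytope: "convex (gz_polytope n lam)"
  unfolding convex_alt
proof (intro ballI allI impI)
  fix x y u assume "x \<in> gz_polytope n lam" "y \<in> gz_polytope n lam" "0 \<le> u \<and> (u::real) \<le> 1"
  then show "(1 - u) *\<^sub>R x + u *\<^sub>R y \<in> gz_polytope n lam"
    unfolding gz_polytope_iff gz_slack_convex
    by (auto simp: coord_space_iff lookup_add lookup_scaleR intro!: add_nonneg_nonneg mult_nonneg_nonneg)
qed

lemma dual_cone_cone_hull: "dual_cone I (cone hull S) = dual_cone I S"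
proof -
  have "dot I u (c *\<^sub>R v) = c * dot I u v" for u v c
    by (simp add: dot_def lookup_scaleR sum_distrib_left algebra_simps)
  then show ?thesis
    unfolding dual_cone_def cone_hull_expl
    by (auto intro!: mult_nonneg_nonneg) (metis order_refl zero_le_one scaleR_one)
qed

lemma dual_cone_at_face:
  assumes F: "F \<subseteq> gz_polytope n lam" and x: "x \<in> F"
    and A: "\<And>y. y \<in> F \<Longrightarrow> gz_active n lam x \<subseteq> gz_active n lam y"
  shows "dual_cone (gz_index n) (cone_at_face (gz_polytope n lam) F) =
         gz_active_cone n (gz_active n lam x)"
proof -
  let ?I = "gz_index n" and ?P = "gz_polytope n lam"
  let ?D = "{y - f | y f. y \<in> ?P \<and> f \<in> F}"
  let ?T = "{v \<in> coord_space ?I. \<forall>k\<in>gz_active n lam x. gz_slack (\<lambda>_. 0) k v \<ge> 0}"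
  have 1: "?D \<subseteq> ?T"
  proof clarify
    fix y f assume y: "y \<in> ?P" and f: "f \<in> F"
    have "y - f \<in> coord_space ?I"
      using y f F by (force simp: gz_polytope_iff coord_space_iff lookup_minus)
    moreover have "gz_slack (\<lambda>_. 0) k (y - f) \<ge> 0" if "k \<in> gz_active n lam x" for k
    proof -
      have "gz_slack lam k f = 0" "k \<in> UNIV \<times> ?I"
        using that A[OF f] by (auto simp: gz_active_def)
      with y show ?thesis
        unfolding gz_slack_diff[where lam=lam] gz_polytope_iff by auto
    qed
    ultimately show "y - f \<in> coord_space ?I \<and> (\<forall>k\<in>gz_active n lam x. 0 \<le> gz_slack (\<lambda>_. 0) k (y - f))"
      by blast
  qed
  have 2: "\<exists>e>0. e *\<^sub>R v \<in> ?D" if v: "v \<in> ?T" for v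
  proof -
    let ?K = "UNIV \<times> ?I :: (bool \<times> nat \<times> nat) set"
    have xP: "x \<in> ?P" using F x by blast
    have "\<exists>e>0. \<forall>k\<in>?K. gz_slack lam k x + e * gz_slack (\<lambda>_. 0) k v \<ge> 0"
    proof -
      have "\<forall>k\<in>?K. \<forall>\<^sub>F e in at_right 0. gz_slack lam k x + e * gz_slack (\<lambda>_. 0) k v \<ge> 0"
      proof
        fix k assume k: "k \<in> ?K"
        show "\<forall>\<^sub>F e in at_right 0. gz_slack lam k x + e * gz_slack (\<lambda>_. 0) k v \<ge> 0"
        proof (cases "gz_slack lam k x = 0")
          case True
          then have "gz_slack (\<lambda>_. 0) k v \<ge> 0"
            using k v by (auto simp: gz_active_def)
          with True show ?thesis
            by (auto simp: eventually_at_right_less intro!: eventually_mono[OF eventually_at_right_less[of 0]])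
        next
          case False
          then have pos: "gz_slack lam k x > 0"
            using xP k by (auto simp: gz_polytope_iff less_le)
          have "((\<lambda>e. gz_slack lam k x + e * gz_slack (\<lambda>_. 0) k v) \<longlongrightarrow>
                 gz_slack lam k x + 0 * gz_slack (\<lambda>_. 0) k v) (at_right 0)"
            by (intro tendsto_intros)
          then have "\<forall>\<^sub>F e in at_right 0. gz_slack lam k x + e * gz_slack (\<lambda>_. 0) k v > 0"
            using pos by (intro order_tendstoD(1)) auto
          then show ?thesis
            by (rule eventually_mono) simp
        qed
      qed
      then have "\<forall>\<^sub>F e in at_right 0. \<forall>k\<in>?K. gz_slack lam k x + e * gz_slack (\<lambda>_. 0) k v \<ge> 0"
        by (intro eventually_ball_finite) (auto simp: finite_gz_index)
      then have "\<forall>\<^sub>F e in at_right (0::real). e > 0 \<and>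
                   (\<forall>k\<in>?K. gz_slack lam k x + e * gz_slack (\<lambda>_. 0) k v \<ge> 0)"
        by (rule eventually_conj[OF eventually_at_right_less])
      then show ?thesis
        using eventually_happens[of _ "at_right (0::real)"] by (auto simp: trivial_limit_at_right_real)
    qed
    then obtain e where e: "e > 0"
      "\<And>k. k \<in> ?K \<Longrightarrow> gz_slack lam k x + e * gz_slack (\<lambda>_. 0) k v \<ge> 0" by blast
    have "x + e *\<^sub>R v \<in> ?P"
      using e xP v
      by (auto simp: gz_polytope_iff gz_slack_add gz_slack_scaleR coord_space_iff lookup_add lookup_scaleR)
    moreover have "e *\<^sub>R v = (x + e *\<^sub>R v) - x" by simp
    ultimately have "e *\<^sub>R v \<in> ?D" using x by blast
    with e(1) show ?thesis by blast
  qed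
  have "dual_cone ?I ?D = dual_cone ?I ?T"
  proof
    show "dual_cone ?I ?T \<subseteq> dual_cone ?I ?D"
      using 1 unfolding dual_cone_def by blast
    show "dual_cone ?I ?D \<subseteq> dual_cone ?I ?T"
    proof
      fix u assume u: "u \<in> dual_cone ?I ?D"
      have "dot ?I u v \<ge> 0" if v: "v \<in> ?T" for v
      proof -
        obtain e where e: "e > 0" "e *\<^sub>R v \<in> ?D" using 2[OF v] by blast
        then have "dot ?I u (e *\<^sub>R v) \<ge> 0"
          using u unfolding dual_cone_def by blast
        moreover have "dot ?I u (e *\<^sub>R v) = e * dot ?I u v"
          by (simp add: dot_def lookup_scaleR sum_distrib_left algebra_simps)
        ultimately show ?thesis
          using e(1) by (simp add: zero_le_mult_iff)
      qed
      then show "u \<in> dual_cone ?I ?T"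
        using u unfolding dual_cone_def by blast
    qed
  qed
  then show ?thesis
    by (simp add: cone_at_face_def dual_cone_cone_hull gz_active_cone_def)
qed

lemma normal_fan_gz_polytope_active:
  "normal_fan (gz_index n) (gz_polytope n lam) =
   (\<lambda>x. gz_active_cone n (gz_active n lam x)) ` gz_polytope n lam" (is "?L = ?R")
proof
  let ?I = "gz_index n" and ?P = "gz_polytope n lam" and ?A = "gz_active n lam"
  show "?L \<subseteq> ?R"
  proof
    fix s assume "s \<in> ?L"
    then obtain F where F: "F face_of ?P" "F \<noteq> {}" and s: "s = dual_cone ?I (cone_at_face ?P F)"
      by (auto simp: normal_fan_def)
    have sub: "F \<subseteq> ?P" and cF: "convex F" using F by (auto simp: face_of_def)
    have finA: "finite (?A x)" for x
      by (rule finite_subset[of _ "UNIV \<times> ?I"]) (auto simp: gz_active_def finite_gz_index)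
    obtain x where x: "x \<in> F" and xm: "\<And>y. y \<in> F \<Longrightarrow> card (?A x) \<le> card (?A y)"
      using F(2) ex_has_least_nat[of "\<lambda>x. x \<in> F" _ "\<lambda>x. card (?A x)"] by blast
    have "?A x \<subseteq> ?A y" if y: "y \<in> F" for y
    proof -
      define z where "z = (1 - 1/2) *\<^sub>R x + (1/2) *\<^sub>R y"
      have z: "z \<in> F" unfolding z_def
        by (rule convexD_alt[OF cF x y]) auto
      have "?A z \<subseteq> ?A x \<inter> ?A y"
      proof
        fix k assume k: "k \<in> ?A z"
        then have K: "k \<in> UNIV \<times> ?I" and 0: "gz_slack lam k x / 2 + gz_slack lam k y / 2 = 0"
          unfolding gz_active_def z_def by (auto simp only: gz_slack_convex mem_Collect_eq) simp
        have "gz_slack lam k x \<ge> 0" "gz_slack lam k y \<ge> 0"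
          using K x y sub by (auto simp: gz_polytope_iff)
        with 0 K show "k \<in> ?A x \<inter> ?A y"
          by (auto simp: gz_active_def)
      qed
      moreover have "?A z = ?A x"
        using calculation xm[OF z] finA[of x]
        by (metis card_mono card_subset_eq le_antisym le_inf_iff)
      ultimately show ?thesis by blast
    qed
    then have "s = gz_active_cone n (?A x)"
      using dual_cone_at_face[OF sub x] s by blast
    then show "s \<in> ?R" using x sub by blast
  qed
  show "?R \<subseteq> ?L"
  proof clarify
    fix x assume x: "x \<in> ?P"
    define F where "F = {y \<in> ?P. ?A x \<subseteq> ?A y}"
    have FP: "F \<subseteq> ?P" and xF: "x \<in> F" using x by (auto simp: F_def)
    have "F face_of ?P"
      unfolding face_of_def
    proof (intro conjI ballI impI)
      show "convex F"
        using convex_gz_polytope[of n lam] unfolding F_def convex_alt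
        by (auto simp: gz_active_def gz_slack_convex subset_iff)
    next
      fix a b y assume ab: "a \<in> ?P" "b \<in> ?P" and y: "y \<in> F" "y \<in> open_segment a b"
      obtain t where t: "0 < t" "t < 1" "y = (1 - t) *\<^sub>R a + t *\<^sub>R b"
        using y(2) by (auto simp: in_segment)
      have *: "gz_slack lam k a = 0 \<and> gz_slack lam k b = 0" if k: "k \<in> ?A x" for k
      proof -
        have K: "k \<in> UNIV \<times> ?I" and 0: "(1 - t) * gz_slack lam k a + t * gz_slack lam k b = 0"
          using k y(1) t(3) by (auto simp: F_def gz_active_def gz_slack_convex subset_iff)
        have "gz_slack lam k a \<ge> 0" "gz_slack lam k b \<ge> 0"
          using K ab by (auto simp: gz_polytope_iff)
        with 0 t(1,2) show ?thesis
          by (smt (verit) mult_pos_pos mult_nonneg_nonneg)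
      qed
      then show "a \<in> F" "b \<in> F"
        using ab by (auto simp: F_def gz_active_def)
    qed (use FP in auto)
    moreover have "dual_cone ?I (cone_at_face ?P F) = gz_active_cone n (?A x)"
      by (rule dual_cone_at_face[OF FP xF]) (auto simp: F_def)
    ultimately show "gz_active_cone n (?A x) \<in> ?L"
      using xF unfolding normal_fan_def by blast
  qed
qed

lemma regular_seq_reparametrize:
  assumes "regular_seq n lam" "regular_seq n mu"
  shows "\<exists>phi. strict_mono phi \<and> (\<forall>j\<in>{1..n}. phi (lam j) = mu j)"
  using assms
proof (induction n)
  case 0
  show ?case by (rule exI[of _ id]) (auto simp: strict_mono_def)
next
  case (Suc m)
  have "regular_seq m lam" "regular_seq m mu"
    using Suc.prems by (auto simp: regular_seq_def strict_mono_on_def)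
  then obtain phi where phi: "strict_mono phi" "\<And>j. j \<in> {1..m} \<Longrightarrow> phi (lam j) = mu j"
    using Suc.IH by blast
  show ?case
  proof (cases "m = 0")
    case True
    show ?thesis
      by (rule exI[of _ "\<lambda>t. t + (mu 1 - lam 1)"]) (auto simp: strict_mono_def True)
  next
    case False
    have lt: "lam m < lam (Suc m)" "mu m < mu (Suc m)"
      using Suc.prems False by (auto simp: regular_seq_def strict_mono_on_def)
    define c where "c = (mu (Suc m) - mu m) / (lam (Suc m) - lam m)"
    have c: "c > 0" using lt by (simp add: c_def)
    define psi where "psi = (\<lambda>t. if t \<le> lam m then phi t else mu m + (t - lam m) * c)"
    have pm: "phi (lam m) = mu m" using phi(2) False by auto
    have "strict_mono psi"
    proof (rule strict_monoI)
      fix s t :: real assume st: "s < t"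
      consider "t \<le> lam m" | "s \<le> lam m" "lam m < t" | "lam m < s" by linarith
      then show "psi s < psi t"
      proof cases
        case 1
        then show ?thesis using st phi(1) by (auto simp: psi_def strict_mono_def)
      next
        case 2
        have "phi s \<le> mu m"
          using 2 phi(1) pm by (metis strict_mono_less_eq)
        moreover have "(t - lam m) * c > 0" using 2 c by simp
        ultimately show ?thesis using 2 by (simp add: psi_def)
      next
        case 3
        then show ?thesis using st c by (simp add: psi_def)
      qed
    qed
    moreover have "psi (lam j) = mu j" if "j \<in> {1..Suc m}" for j
    proof (cases "j = Suc m")
      case True
      then show ?thesis using lt by (simp add: psi_def c_def)
    next
      case False
      then have j: "j \<in> {1..m}" using that by auto
      have "lam j \<le> lam m"
        using Suc.prems(1) j unfolding regular_seq_def
        by (cases "j = m") (auto simp: strict_mono_on_def intro!: less_imp_le)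
      then show ?thesis using phi(2)[OF j] by (simp add: psi_def)
    qed
    ultimately show ?thesis by blast
  qed
qed

lemma gz_active_reparametrize:
  assumes "regular_seq n lam" "regular_seq n mu" and x: "x \<in> gz_polytope n lam"
  shows "\<exists>y\<in>gz_polytope n mu. gz_active n mu y = gz_active n lam x"
proof -
  obtain phi where phi: "strict_mono phi" "\<And>j. j \<in> {1..n} \<Longrightarrow> phi (lam j) = mu j"
    using regular_seq_reparametrize[OF assms(1,2)] by blast
  define f where "f = (\<lambda>k. if k \<in> gz_index n then phi (Poly_Mapping.lookup x k) else 0)"
  define y where "y = Abs_poly_mapping f"
  have "finite {k. f k \<noteq> 0}"
    by (rule finite_subset[OF _ finite_gz_index[of n]]) (auto simp: f_def)
  then have ly: "Poly_Mapping.lookup y = f" by (simp add: y_def)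
  have e1: "gz_entry mu y i j = phi (gz_entry lam x i j)" if "(i, j) \<in> gz_index n" for i j
    using that by (auto simp: gz_entry_def ly f_def gz_index_def)
  have e2: "gz_entry mu y (i - 1) j = phi (gz_entry lam x (i - 1) j)"
           "gz_entry mu y (i - 1) (j + 1) = phi (gz_entry lam x (i - 1) (j + 1))"
    if "(i, j) \<in> gz_index n" for i j
  proof -
    have "i - 1 \<noteq> 0 \<Longrightarrow> (i - 1, j) \<in> gz_index n \<and> (i - 1, j + 1) \<in> gz_index n"
      using that by (auto simp: gz_index_def)
    moreover have "j \<in> {1..n} \<and> j + 1 \<in> {1..n}"
      using that by (auto simp: gz_index_def)
    ultimately show "gz_entry mu y (i - 1) j = phi (gz_entry lam x (i - 1) j)"
           "gz_entry mu y (i - 1) (j + 1) = phi (gz_entry lam x (i - 1) (j + 1))"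
      using phi(2) by (auto simp: gz_entry_def ly f_def)
  qed
  have "gz_slack mu k y \<ge> 0 \<longleftrightarrow> gz_slack lam k x \<ge> 0"
       "gz_slack mu k y = 0 \<longleftrightarrow> gz_slack lam k x = 0" if "k \<in> UNIV \<times> gz_index n" for k
    using that e1 e2 strict_mono_less_eq[OF phi(1)] strict_mono_eq[OF phi(1)]
    by (auto simp: gz_slack_def)
  then have "y \<in> gz_polytope n mu" "gz_active n mu y = gz_active n lam x"
    using x by (auto simp: gz_polytope_iff gz_active_def coord_space_iff ly f_def)
  then show ?thesis by blast
qed

lemma normal_fan_gz_polytope:
  assumes "regular_seq n lam"
  shows "normal_fan (gz_index n) (gz_polytope n lam) = gz_fan n"
proof -
  have r: "regular_seq n real" by (simp add: regular_seq_def strict_mono_on_def)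
  have *: "(\<lambda>x. gz_active_cone n (gz_active n l x)) ` gz_polytope n l \<subseteq>
        (\<lambda>x. gz_active_cone n (gz_active n m x)) ` gz_polytope n m"
    if lm: "regular_seq n l" "regular_seq n m" for l m
  proof clarify
    fix x assume "x \<in> gz_polytope n l"
    then obtain y where "y \<in> gz_polytope n m" "gz_active n m y = gz_active n l x"
      using gz_active_reparametrize[OF lm] by blast
    then show "gz_active_cone n (gz_active n l x) \<in>
        (\<lambda>x. gz_active_cone n (gz_active n m x)) ` gz_polytope n m"
      by (metis image_eqI)
  qed
  show ?thesis
    unfolding gz_fan_def normal_fan_gz_polytope_active
    using *[OF assms r] *[OF r assms] by blast
qed

end

theory Submission
  imports Defs
begin

text \<open>
  Let \<open>h\<close> assign to each facet normal of the Gelfand-Zetlin polytope its minimum over \<open>P\<close>. The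
  cones of \<open>\<Sigma>\<^sub>G\<^sub>Z\<close> cover the space and, by Farkas' lemma, are generated by these normals, so \<open>P\<close>
  is cut out by the corresponding inequalities with right-hand sides \<open>h\<close>. The edges of the
  triangular array form diamonds. The two normals on the lower side of a diamond and the two on
  its upper side have the same sum, and all four lie in a common cone of the fan, on which the
  support function is linear. So \<open>h\<close> satisfies the same relation around each diamond, and is
  therefore the coboundary of a function \<open>\<phi>\<close> on the array. Translating by \<open>\<phi>\<close> turns \<open>P\<close> into
  \<open>\<Delta>\<^sub>\<lambda>\<close> where \<open>\<lambda>\<close> is minus the top row of \<open>\<phi>\<close>. If \<open>P\<close> is a lattice polytope then \<open>h\<close>, and hence
  \<open>\<phi>\<close>, is integral.
\<close>

section \<open>Farkas' lemma and separation\<close>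

text \<open>Bartl's induction, which needs neither a topology nor finite dimension.\<close>

lemma farkas:
  fixes a :: "'k \<Rightarrow> 'v::real_vector \<Rightarrow> real"
  assumes "finite K" "\<And>k. k \<in> K \<Longrightarrow> linear (a k)" "linear u"
    and "\<And>v. (\<forall>k\<in>K. a k v \<ge> 0) \<Longrightarrow> u v \<ge> 0"
  shows "\<exists>t. (\<forall>k\<in>K. t k \<ge> 0) \<and> (\<forall>v. u v = (\<Sum>k\<in>K. t k * a k v))"
  using assms
proof (induction K arbitrary: a u)
  case empty
  have "u v = 0" for v
    using empty.prems(3)[of v] empty.prems(3)[of "-v"] linear_neg[OF empty.prems(2), of v] by auto
  then show ?case by simp
next
  case (insert m K)
  show ?case
  proof (cases "\<forall>v. (\<forall>k\<in>K. a k v \<ge> 0) \<longrightarrow> u v \<ge> 0")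
    case True
    with insert.IH[of a u] insert.prems obtain t
      where t: "\<forall>k\<in>K. t k \<ge> 0" "\<forall>v. u v = (\<Sum>k\<in>K. t k * a k v)" by auto
    have "(\<Sum>k\<in>insert m K. (t(m := 0)) k * a k v) = (\<Sum>k\<in>K. t k * a k v)" for v
      using insert.hyps by (auto intro!: sum.cong)
    with t show ?thesis by (intro exI[of _ "t(m := 0)"]) auto
  next
    case False
    then obtain w where w: "\<forall>k\<in>K. a k w \<ge> 0" "u w < 0" by force
    have lm: "linear (a m)" and lu: "linear u" and lk: "\<And>k. k \<in> K \<Longrightarrow> linear (a k)"
      using insert.prems by auto
    have neg: "a m w < 0"
      using insert.prems(3)[of w] w by (smt (verit) insert_iff)
    \<comment> \<open>Scaling \<open>w\<close> so that \<open>a m z = -1\<close> makes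
      \<open>v \<mapsto> v + a m v *\<^sub>R z\<close> the projection onto the kernel of
      \<open>a m\<close> along \<open>z\<close>.\<close>
    define z where "z = (- 1 / a m w) *\<^sub>R w"
    have scale: "f z = f w / - a m w" if "linear f" for f :: "'v \<Rightarrow> real"
      unfolding z_def using that by (simp only: linear_cmul) simp
    have z: "a m z = - 1" "u z < 0" "\<And>k. k \<in> K \<Longrightarrow> a k z \<ge> 0"
      using neg w scale[OF lm] scale[OF lu] scale[OF lk]
      by (auto simp: zero_less_divide_iff divide_le_0_iff)
    \<comment> \<open>These are \<open>a k\<close> and \<open>u\<close> composed with that
      projection. Its image satisfies constraint \<open>m\<close> with equality, so the induction
      hypothesis applies with \<open>K\<close> alone.\<close>
    define a' where "a' k v = a k v + a k z * a m v" for k v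
    define u' where "u' v = u v + u z * a m v" for v
    have shift: "f (v + a m v *\<^sub>R z) = f v + f z * a m v" if "linear f" for f :: "'v \<Rightarrow> real" and v
      using that by (simp add: linear_add linear_cmul)
    have "\<exists>t. (\<forall>k\<in>K. t k \<ge> 0) \<and> (\<forall>v. u' v = (\<Sum>k\<in>K. t k * a' k v))"
    proof (rule insert.IH)
      show "linear (a' k)" if "k \<in> K" for k
        using lk[OF that] lm unfolding a'_def linear_iff by (simp add: algebra_simps)
      show "linear u'"
        using lu lm unfolding u'_def linear_iff by (simp add: algebra_simps)
      show "u' v \<ge> 0" if "\<forall>k\<in>K. a' k v \<ge> 0" for v
        using insert.prems(3)[of "v + a m v *\<^sub>R z"] that
        by (auto simp: shift lk lm lu z(1) a'_def u'_def)
    qed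
    then obtain t where t: "\<And>k. k \<in> K \<Longrightarrow> t k \<ge> 0" "\<And>v. u' v = (\<Sum>k\<in>K. t k * a' k v)"
      by blast
    \<comment> \<open>The coefficient of \<open>a m\<close> left over when \<open>u'\<close> and
      \<open>a'\<close> are expanded.\<close>
    define s where "s = (\<Sum>k\<in>K. t k * a k z) - u z"
    have "s \<ge> 0"
      using t(1) z(2,3) by (auto simp: s_def intro!: order_trans[OF less_imp_le sum_nonneg])
    have "u v = (\<Sum>k\<in>insert m K. (t(m := s)) k * a k v)" for v
    proof -
      have "u v = (\<Sum>k\<in>K. t k * a k v) + s * a m v"
        using t(2)[of v]
        by (simp add: u'_def a'_def s_def algebra_simps sum.distrib sum_distrib_left)
      also have "(\<Sum>k\<in>K. t k * a k v) = (\<Sum>k\<in>K. (t(m := s)) k * a k v)"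
        using insert.hyps by (auto intro!: sum.cong)
      finally show ?thesis using insert.hyps by simp
    qed
    then show ?thesis
      using t(1) \<open>s \<ge> 0\<close> by (intro exI[of _ "t(m := s)"]) auto
  qed
qed

section \<open>The inner product on the coordinate space\<close>

lemma linear_dot_left: "linear (\<lambda>u. dot I u v)"
  by (simp add: linear_iff dot_def lookup_add lookup_scaleR algebra_simps sum.distrib sum_distrib_left)

lemma dot_commute: "dot I u v = dot I v u"
  by (simp add: dot_def mult.commute)

lemma linear_dot_right: "linear (dot I u)"
  using linear_dot_left[of I u] by (simp add: dot_commute[of I _ u])

lemma dot_single: "finite I \<Longrightarrow> i \<in> I \<Longrightarrow> dot I (Poly_Mapping.single i 1) v = Poly_Mapping.lookup v i"
  by (simp add: dot_def lookup_single when_def if_distrib[of "\<lambda>a. a * _"] cong: if_cong)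

lemma dot_cong_left:
  "(\<And>i. i \<in> I \<Longrightarrow> Poly_Mapping.lookup u i = Poly_Mapping.lookup u' i) \<Longrightarrow> dot I u v = dot I u' v"
  by (simp add: dot_def)

lemma coord_space_eqI:
  assumes "x \<in> coord_space I" "y \<in> coord_space I"
    and "\<And>i. i \<in> I \<Longrightarrow> Poly_Mapping.lookup x i = Poly_Mapping.lookup y i"
  shows "x = y"
  using assms by (intro poly_mapping_eqI) (metis coord_space_iff)

lemma coord_space_exists:
  assumes "finite I"
  obtains x where "x \<in> coord_space I" "\<And>i. i \<in> I \<Longrightarrow> Poly_Mapping.lookup x i = f i"
proof
  let ?g = "\<lambda>i. if i \<in> I then f i else 0"
  have "finite {i. ?g i \<noteq> 0}"
    by (rule finite_subset[OF _ assms]) auto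
  then have *: "Poly_Mapping.lookup (Abs_poly_mapping ?g) = ?g" by simp
  show "Abs_poly_mapping ?g \<in> coord_space I"
    unfolding coord_space_iff * by simp
  show "Poly_Mapping.lookup (Abs_poly_mapping ?g) i = f i" if "i \<in> I" for i
    unfolding * using that by simp
qed

section \<open>Separation from a polytope and vertices as minimizers\<close>

lemma convex_linear_ge:
  fixes g :: "'v::real_vector \<Rightarrow> real"
  assumes "linear g"
  shows "convex {x. m \<le> g x}"
  using convex_linear_vimage[OF assms convex_real_interval(1)[of m]] by (simp add: vimage_def)

text \<open>Farkas' lemma is applied to pairs \<open>(u, s)\<close>, each standing for the
  half-space \<open>s \<le> dot I u x\<close>. If no half-space contained the generators of
  \<open>P\<close> and missed \<open>y\<close>, the multipliers would write \<open>y\<close> as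
  their convex combination.\<close>

lemma polytope_separation:
  fixes P :: "('i \<Rightarrow>\<^sub>0 real) set"
  assumes I: "finite I" and P: "polytope P" "P \<subseteq> coord_space I"
    and y: "y \<in> coord_space I" "y \<notin> P"
  shows "\<exists>u\<in>coord_space I. \<forall>x\<in>P. dot I u y < dot I u x"
proof -
  obtain W where W: "finite W" "P = convex hull W" using P(1) by (auto simp: polytope_def)
  have WP: "W \<subseteq> P" using W hull_subset[of W convex] by simp
  let ?a = "\<lambda>w (p :: ('i \<Rightarrow>\<^sub>0 real) \<times> real). dot I (fst p) w - snd p"
  have lin: "linear (?a w)" for w
    using linear_dot_left[of I w] unfolding linear_iff by (simp add: algebra_simps)
  have "\<exists>p. (\<forall>w\<in>W. ?a w p \<ge> 0) \<and> ?a y p < 0"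
  proof (rule ccontr)
    assume "\<not> ?thesis"
    then have "\<exists>t. (\<forall>w\<in>W. t w \<ge> 0) \<and> (\<forall>p. ?a y p = (\<Sum>w\<in>W. t w * ?a w p))"
      by (intro farkas[OF W(1) lin lin]) force
    then obtain t where t: "\<forall>w\<in>W. t w \<ge> 0" "\<And>p. ?a y p = (\<Sum>w\<in>W. t w * ?a w p)" by blast
    have "sum t W = 1"
      using t(2)[of "(0, - 1)"] by (simp add: dot_def)
    moreover have "(\<Sum>w\<in>W. t w *\<^sub>R w) = y"
    proof (rule coord_space_eqI)
      show "(\<Sum>w\<in>W. t w *\<^sub>R w) \<in> coord_space I"
        using WP P(2) by (force simp: coord_space_iff lookup_sum lookup_scaleR intro!: sum.neutral)
      show "Poly_Mapping.lookup (\<Sum>w\<in>W. t w *\<^sub>R w) i = Poly_Mapping.lookup y i" if "i \<in> I" for i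
        using t(2)[of "(Poly_Mapping.single i 1, 0)"] that
        by (simp add: dot_single I lookup_sum lookup_scaleR)
    qed (rule y)
    ultimately have "y \<in> P"
      using t(1) by (auto simp: W(2) convex_hull_finite[OF W(1)])
    with y show False by simp
  qed
  then obtain u s where us: "\<And>w. w \<in> W \<Longrightarrow> s \<le> dot I u w" "dot I u y < s" by force
  have "convex {x. s \<le> dot I u x}"
    by (rule convex_linear_ge[OF linear_dot_right])
  then have "P \<subseteq> {x. s \<le> dot I u x}"
    unfolding W(2) using us(1) by (intro hull_minimal) auto
  \<comment> \<open>The normal found may have support outside \<open>I\<close>; cutting it down to
    \<open>I\<close> leaves all products unchanged.\<close>
  moreover obtain u' where "u' \<in> coord_space I"
    "\<And>i. i \<in> I \<Longrightarrow> Poly_Mapping.lookup u' i = Poly_Mapping.lookup u i"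
    using coord_space_exists[OF I] by blast
  moreover from this have "dot I u' x = dot I u x" for x by (intro dot_cong_left)
  ultimately show ?thesis using us(2) by (intro bexI[of _ u']) fastforce+
qed

text \<open>In a generating set of least cardinality no point is redundant, so each is extreme, and
  the best of them minimizes \<open>g\<close> over the hull.\<close>

lemma polytope_linear_min:
  fixes g :: "'v::real_vector \<Rightarrow> real"
  assumes "polytope P" "P \<noteq> {}" "linear g"
  shows "\<exists>v. v extreme_point_of P \<and> (\<forall>x\<in>P. g v \<le> g x)"
proof -
  obtain W where W: "finite W \<and> P = convex hull W"
    and Wmin: "\<And>W'. finite W' \<and> P = convex hull W' \<Longrightarrow> card W \<le> card W'"
    using assms(1) ex_has_least_nat[of "\<lambda>W. finite W \<and> P = convex hull W" _ card]
    unfolding polytope_def by blast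
  have "W \<noteq> {}" using W assms(2) by auto
  then obtain v where v: "v \<in> W" "\<And>w. w \<in> W \<Longrightarrow> g v \<le> g w"
    using W by (metis arg_min_if_finite(1) arg_min_least)
  have "v \<notin> convex hull (W - {v})"
  proof
    assume "v \<in> convex hull (W - {v})"
    then have "P = convex hull (W - {v})"
      using W v(1) by (metis hull_redundant insert_Diff)
    then have "card W \<le> card (W - {v})" using W by (intro Wmin) auto
    then show False using v(1) W by (metis card_Diff1_less not_le)
  qed
  then have "v extreme_point_of P"
    using extreme_point_of_convex_hull_insert[of "W - {v}" v] W v(1) by (simp add: insert_absorb)
  moreover have "convex {x. g v \<le> g x}"
    by (rule convex_linear_ge[OF assms(3)])
  then have "P \<subseteq> {x. g v \<le> g x}"
    using W v(2) by (metis hull_minimal mem_Collect_eq subsetI)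
  ultimately show ?thesis by blast
qed

section \<open>Normal fans\<close>

lemma mem_dual_cone_at_face:
  "u \<in> dual_cone I (cone_at_face P F) \<longleftrightarrow>
    u \<in> coord_space I \<and> (\<forall>f\<in>F. \<forall>x\<in>P. dot I u f \<le> dot I u x)"
proof -
  have "dot I u (x - f) = dot I u x - dot I u f" for x f
    by (rule linear_diff[OF linear_dot_right])
  then show ?thesis
    unfolding cone_at_face_def dual_cone_cone_hull by (force simp: dual_cone_def)
qed

text \<open>Any point of the face defining \<open>\<sigma>\<close> will do. One point serves all
  \<open>u\<close> in \<open>\<sigma>\<close>, which makes the support function linear on
  \<open>\<sigma>\<close>.\<close>

lemma normal_fan_minimizer:
  assumes "\<sigma> \<in> normal_fan I P"
  obtains f where "f \<in> P" "\<And>u x. u \<in> \<sigma> \<Longrightarrow> x \<in> P \<Longrightarrow> dot I u f \<le> dot I u x"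
proof -
  obtain F where F: "F face_of P" "F \<noteq> {}" "\<sigma> = dual_cone I (cone_at_face P F)"
    using assms by (auto simp: normal_fan_def)
  then obtain f where "f \<in> F" "f \<in> P" using face_of_imp_subset by blast
  then show ?thesis using that F(3) by (auto simp: mem_dual_cone_at_face)
qed

text \<open>The points of \<open>P\<close> where \<open>u\<close> is minimal form a face, and
  \<open>u\<close> lies in its normal cone.\<close>

lemma normal_fan_covers:
  assumes P: "polytope P" "P \<noteq> {}" and u: "u \<in> coord_space I"
  shows "\<exists>\<sigma>\<in>normal_fan I P. u \<in> \<sigma>"
proof -
  note lin = linear_dot_right[of I u]
  obtain v where v: "v \<in> P" "\<And>x. x \<in> P \<Longrightarrow> dot I u v \<le> dot I u x"
    using polytope_linear_min[OF P lin] by (auto simp: extreme_point_of_def)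
  define F where "F = {x\<in>P. dot I u x = dot I u v}"
  have cP: "convex P" using P(1) polytope_imp_convex by blast
  have comb: "dot I u ((1 - t) *\<^sub>R a + t *\<^sub>R b) = (1 - t) * dot I u a + t * dot I u b" for t a b
    using lin by (simp add: linear_iff)
  have "F face_of P"
    unfolding face_of_def
  proof (intro conjI ballI impI)
    show "F \<subseteq> P" by (auto simp: F_def)
    show "convex F"
      using cP unfolding F_def convex_alt by (simp add: comb) (simp add: algebra_simps)
    fix a b y assume ab: "a \<in> P" "b \<in> P" and y: "y \<in> F" "y \<in> open_segment a b"
    obtain t where t: "0 < t" "t < 1" "y = (1 - t) *\<^sub>R a + t *\<^sub>R b"
      using y(2) by (auto simp: in_segment)
    have "(1 - t) * dot I u a + t * dot I u b = dot I u v"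
      using y(1) comb[of t a b] by (simp add: F_def t(3))
    then have "(1 - t) * (dot I u a - dot I u v) + t * (dot I u b - dot I u v) = 0"
      by (simp add: algebra_simps)
    moreover have "dot I u a - dot I u v \<ge> 0" "dot I u b - dot I u v \<ge> 0"
      using v(2) ab by auto
    ultimately have "dot I u a - dot I u v = 0 \<and> dot I u b - dot I u v = 0"
      using t(1,2) by (smt (verit) mult_pos_pos mult_nonneg_nonneg)
    then show "a \<in> F" "b \<in> F" using ab by (auto simp: F_def)
  qed
  moreover have "v \<in> F" using v by (simp add: F_def)
  moreover have "u \<in> dual_cone I (cone_at_face P F)"
    using u v(2) by (auto simp: mem_dual_cone_at_face F_def)
  ultimately show ?thesis unfolding normal_fan_def by blast
qed

section \<open>The normals of the Gelfand-Zetlin polytope\<close>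

text \<open>Row 0 holds the constants \<open>lam j\<close>, whose linear part is 0.\<close>

definition gz_unit :: "nat \<Rightarrow> nat \<Rightarrow> (nat \<times> nat \<Rightarrow>\<^sub>0 real)" where
  "gz_unit i j = (if i = 0 then 0 else Poly_Mapping.single (i, j) 1)"

text \<open>The gradient of the affine function \<open>gz_slack lam (b, i, j)\<close>, the same for
  every \<open>lam\<close>.\<close>

definition gz_normal :: "bool \<times> nat \<times> nat \<Rightarrow> (nat \<times> nat \<Rightarrow>\<^sub>0 real)" where
  "gz_normal = (\<lambda>(b, i, j).
     if b then gz_unit i j - gz_unit (i - 1) j else gz_unit (i - 1) (j + 1) - gz_unit i j)"

lemma dot_gz_unit:
  assumes "i = 0 \<or> (i, j) \<in> gz_index n"
  shows "dot (gz_index n) (gz_unit i j) v = gz_entry (\<lambda>_. 0) v i j"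
  using assms by (auto simp: gz_unit_def gz_entry_def dot_single finite_gz_index linear_0[OF linear_dot_left])

lemma gz_unit_in_coord_space:
  "i = 0 \<or> (i, j) \<in> gz_index n \<Longrightarrow> gz_unit i j \<in> coord_space (gz_index n)"
  by (auto simp: gz_unit_def coord_space_iff lookup_single when_def)

lemma gz_index_above:
  assumes "(i, j) \<in> gz_index n"
  shows "i - 1 = 0 \<or> (i - 1, j) \<in> gz_index n" "i - 1 = 0 \<or> (i - 1, j + 1) \<in> gz_index n"
  using assms by (auto simp: gz_index_def)

lemma dot_gz_normal:
  assumes "k \<in> UNIV \<times> gz_index n"
  shows "dot (gz_index n) (gz_normal k) v = gz_slack (\<lambda>_. 0) k v"
proof -
  obtain b i j where k: "k = (b, i, j)" "(i, j) \<in> gz_index n" using assms by auto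
  have d: "dot (gz_index n) (x - y) v = dot (gz_index n) x v - dot (gz_index n) y v" for x y
    by (rule linear_diff[OF linear_dot_left])
  show ?thesis
    unfolding k gz_normal_def gz_slack_def
    using dot_gz_unit[OF disjI2[OF k(2)]] dot_gz_unit[OF gz_index_above(1)[OF k(2)]]
      dot_gz_unit[OF gz_index_above(2)[OF k(2)]]
    by (simp add: d)
qed

lemma gz_normal_in_coord_space:
  assumes "k \<in> UNIV \<times> gz_index n"
  shows "gz_normal k \<in> coord_space (gz_index n)"
proof -
  obtain b i j where k: "k = (b, i, j)" "(i, j) \<in> gz_index n" using assms by auto
  have d: "x - y \<in> coord_space (gz_index n)"
    if "x \<in> coord_space (gz_index n)" "y \<in> coord_space (gz_index n)"
    for x y :: "nat \<times> nat \<Rightarrow>\<^sub>0 real"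
    using that by (simp add: coord_space_iff lookup_minus)
  show ?thesis
    unfolding k gz_normal_def
    using gz_unit_in_coord_space[OF disjI2[OF k(2)]]
      gz_unit_in_coord_space[OF gz_index_above(1)[OF k(2)]]
      gz_unit_in_coord_space[OF gz_index_above(2)[OF k(2)]]
    by (auto intro!: d)
qed

text \<open>Both sides telescope to \<open>gz_unit i (j + 1) - gz_unit i j\<close>, one through row
  \<open>i - 1\<close> and the other through row \<open>i + 1\<close>.\<close>

lemma gz_normal_diamond:
  "i \<ge> 1 \<Longrightarrow> gz_normal (False, i, j) + gz_normal (True, i, j + 1) =
     gz_normal (True, i + 1, j) + gz_normal (False, i + 1, j)"
  by (simp add: gz_normal_def)

lemma gz_normal_in_gz_active_cone:
  assumes "A \<subseteq> UNIV \<times> gz_index n" "k \<in> A"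
  shows "gz_normal k \<in> gz_active_cone n A"
  using assms gz_normal_in_coord_space[of k n] dot_gz_normal[of k n]
  by (auto simp: gz_active_cone_def dual_cone_def)

text \<open>The active cone is the dual of a cone cut out by the normals in \<open>A\<close>, so
  Farkas' lemma yields these normals as generators.\<close>

lemma gz_active_cone_generated:
  assumes A: "A \<subseteq> UNIV \<times> gz_index n" and u: "u \<in> gz_active_cone n A"
  shows "\<exists>t. (\<forall>k\<in>A. t k \<ge> 0) \<and>
    (\<forall>v. dot (gz_index n) u v = (\<Sum>k\<in>A. t k * dot (gz_index n) (gz_normal k) v))"
proof (rule farkas)
  show "finite A"
    using A by (rule finite_subset) (simp add: finite_gz_index)
  fix v assume v: "\<forall>k\<in>A. dot (gz_index n) (gz_normal k) v \<ge> 0"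
  obtain v' where v': "v' \<in> coord_space (gz_index n)"
    "\<And>i. i \<in> gz_index n \<Longrightarrow> Poly_Mapping.lookup v' i = Poly_Mapping.lookup v i"
    using coord_space_exists[OF finite_gz_index] by blast
  then have eq: "dot (gz_index n) x v' = dot (gz_index n) x v" for x
    by (simp add: dot_def)
  have "gz_slack (\<lambda>_. 0) k v' \<ge> 0" if "k \<in> A" for k
    using dot_gz_normal[of k n v'] eq v A that by (metis subsetD)
  then have "dot (gz_index n) u v' \<ge> 0"
    using u v'(1) by (simp add: gz_active_cone_def dual_cone_def)
  then show "dot (gz_index n) u v \<ge> 0" by (simp add: eq)
qed (rule linear_dot_right)+

text \<open>
  The entry \<open>x\<^sub>i\<^sub>j\<close> ranges over \<open>[j, i + j]\<close> when \<open>\<lambda> = (1, \<dots>, n)\<close>. Clamping \<open>j\<^sub>0 + 1\<close> to these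
  intervals gives a point at which the four entries of a diamond coincide.
\<close>

lemma gz_diamond_active:
  assumes "i\<^sub>0 \<ge> 1"
  shows "\<exists>x\<in>gz_polytope n real. (i\<^sub>0 + 1, j\<^sub>0) \<in> gz_index n \<longrightarrow>
    {(True, i\<^sub>0 + 1, j\<^sub>0), (False, i\<^sub>0 + 1, j\<^sub>0), (False, i\<^sub>0, j\<^sub>0), (True, i\<^sub>0, j\<^sub>0 + 1)}
      \<subseteq> gz_active n real x"
proof -
  define f where "f i j = max (real j) (min (real (j\<^sub>0 + 1)) (real (i + j)))" for i j
  obtain x where x: "x \<in> coord_space (gz_index n)"
    "\<And>p. p \<in> gz_index n \<Longrightarrow> Poly_Mapping.lookup x p = f (fst p) (snd p)"
    using coord_space_exists[OF finite_gz_index, of n "\<lambda>p. f (fst p) (snd p)"] by blast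
  \<comment> \<open>In row 0 the interval is the single point \<open>j\<close>, so clamping returns
    the prescribed value.\<close>
  have e: "gz_entry real x i j = f i j" if "i = 0 \<or> (i, j) \<in> gz_index n" for i j
    using that x(2)[of "(i, j)"] by (auto simp: gz_entry_def f_def)
  have s: "gz_slack real (b, i, j) x = (if b then f i j - f (i - 1) j else f (i - 1) (j + 1) - f i j)"
    if "(i, j) \<in> gz_index n" for b i j
    using that e[OF gz_index_above(1)[OF that]] e[OF gz_index_above(2)[OF that]] e[of i j]
    by (simp add: gz_slack_def)
  have "gz_slack real (b, i, j) x \<ge> 0" if "(i, j) \<in> gz_index n" for b i j
    using that unfolding s[OF that] by (auto simp: f_def gz_index_def)
  then have "x \<in> gz_polytope n real"
    using x(1) by (auto simp: gz_polytope_iff)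
  \<comment> \<open>By \<open>i\<^sub>0 \<ge> 1\<close> the intervals of all four positions of the
    diamond contain \<open>j\<^sub>0 + 1\<close>, so clamping changes nothing there.\<close>
  moreover have "(b, i\<^sub>0 + 1, j\<^sub>0) \<in> gz_active n real x" "(False, i\<^sub>0, j\<^sub>0) \<in> gz_active n real x"
    "(True, i\<^sub>0, j\<^sub>0 + 1) \<in> gz_active n real x" if "(i\<^sub>0 + 1, j\<^sub>0) \<in> gz_index n" for b
  proof -
    have mem: "(i\<^sub>0, j\<^sub>0) \<in> gz_index n" "(i\<^sub>0, j\<^sub>0 + 1) \<in> gz_index n"
      using that assms by (auto simp: gz_index_def)
    show "(b, i\<^sub>0 + 1, j\<^sub>0) \<in> gz_active n real x"
      using s[OF that, of b] that assms by (simp add: gz_active_def f_def)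
    show "(False, i\<^sub>0, j\<^sub>0) \<in> gz_active n real x" "(True, i\<^sub>0, j\<^sub>0 + 1) \<in> gz_active n real x"
      using s[OF mem(1), of False] s[OF mem(2), of True] mem assms
      by (simp_all add: gz_active_def f_def)
  qed
  ultimately show ?thesis by (intro bexI[of _ x]) simp_all
qed

section \<open>Integrating the support numbers\<close>

text \<open>Integrates \<open>h\<close> from the value 0 at position \<open>(0, 1)\<close>: down
  column 1 along the lower inequalities, then from each column to the next along the upper ones.
  Columns start at 1, so the value at column 0 is a dummy.\<close>

fun gz_potential :: "(bool \<times> nat \<times> nat \<Rightarrow> real) \<Rightarrow> nat \<Rightarrow> nat \<Rightarrow> real" where
  "gz_potential h i 0 = 0"
| "gz_potential h i (Suc 0) = (\<Sum>k=1..i. h (True, k, 1))"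
| "gz_potential h i (Suc (Suc j)) = gz_potential h (Suc i) (Suc j) + h (False, Suc i, Suc j)"

lemma gz_potential_upper:
  assumes "i \<ge> 1" "j \<ge> 1"
  shows "gz_potential h (i - 1) (j + 1) - gz_potential h i j = h (False, i, j)"
  using assms by (cases j) auto

text \<open>Column 1 satisfies this by construction. The diamond relation carries it from row
  \<open>i + 1\<close> of column \<open>j\<close> to row \<open>i\<close> of column
  \<open>j + 1\<close>.\<close>

lemma gz_potential_lower:
  assumes "\<And>i j. i \<ge> 1 \<Longrightarrow> (i + 1, j) \<in> gz_index n \<Longrightarrow>
      h (False, i, j) + h (True, i, j + 1) = h (True, i + 1, j) + h (False, i + 1, j)"
    and "(i, j) \<in> gz_index n"
  shows "gz_potential h i j - gz_potential h (i - 1) j = h (True, i, j)"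
proof -
  have "j \<ge> 1" using assms(2) by (simp add: gz_index_def)
  then show ?thesis
    using assms(2)
  proof (induction j arbitrary: i rule: dec_induct)
    case base
    then obtain m where "i = Suc m" by (cases i) (auto simp: gz_index_def)
    then show ?case by simp
  next
    case (step j)
    from step.prems have i: "i \<ge> 1" and mem: "(i + 1, j) \<in> gz_index n"
      using step.hyps by (auto simp: gz_index_def)
    have "gz_potential h (i + 1) j - gz_potential h i j = h (True, i + 1, j)"
      using step.IH[OF mem] by simp
    then show ?case
      using gz_potential_upper[of "i + 1" j h] gz_potential_upper[of i j h] i step.hyps
        assms(1)[OF i mem] by simp
  qed
qed

text \<open>The potential is a sum of values of \<open>h\<close> at valid indices. The range
  \<open>i + j \<le> n\<close> includes row 0, which later supplies \<open>lam\<close>.\<close>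

lemma gz_potential_Ints:
  assumes h: "\<And>k. k \<in> UNIV \<times> gz_index n \<Longrightarrow> h k \<in> \<int>" and "j \<ge> 1" "i + j \<le> n"
  shows "gz_potential h i j \<in> \<int>"
  using assms(2,3)
proof (induction j arbitrary: i rule: dec_induct)
  case base
  then show ?case by (auto simp: gz_index_def intro!: Ints_sum h)
next
  case (step j)
  then have "gz_potential h (i + 1) j \<in> \<int>" "h (False, i + 1, j) \<in> \<int>"
    by (auto simp: gz_index_def intro!: h)
  then show ?case
    using gz_potential_upper[of "i + 1" j h] step.hyps
    by (metis Ints_add add_diff_cancel_right' diff_add_cancel le_add2 plus_1_eq_Suc add.commute)
qed

theorem proposition1p3:
  fixes n :: nat and P :: "(nat \<times> nat \<Rightarrow>\<^sub>0 real) set"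
  assumes "n \<ge> 1"
    and "P \<subseteq> coord_space (gz_index n)" and "polytope P"
    and "normal_fan (gz_index n) P = gz_fan n"
  shows "(\<exists>lam c. increasing_seq n lam \<and> c \<in> coord_space (gz_index n) \<and>
            P = (+) c ` gz_polytope n lam) \<and>
         (lattice_polytope P \<longrightarrow>
            (\<exists>lam c. dominant_weight n lam \<and>
               c \<in> coord_space (gz_index n) \<and> c \<in> lattice_points \<and>
               P = (+) c ` gz_polytope n lam))"
proof -
  let ?I = "gz_index n" and ?K = "UNIV \<times> gz_index n :: (bool \<times> nat \<times> nat) set"
  let ?d = "dot (gz_index n)" and ?s = "gz_slack (\<lambda>_. 0)"
  have active: "gz_active n real x \<subseteq> ?K" for x by (auto simp: gz_active_def)
  have fan: "normal_fan ?I P = (\<lambda>x. gz_active_cone n (gz_active n real x)) ` gz_polytope n real"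
    using assms(4) by (simp add: gz_fan_def normal_fan_gz_polytope_active)
  \<comment> \<open>Membership in the polytope is not conditional on the diamond being present, so
    this also covers small \<open>n\<close>.\<close>
  obtain x\<^sub>0 where "x\<^sub>0 \<in> gz_polytope n real" using gz_diamond_active[of 1 n 1] by auto
  then have ne: "P \<noteq> {}"
    using fan normal_fan_minimizer[of _ ?I P] by (metis empty_iff imageI)

  have "\<exists>v. v extreme_point_of P \<and> (\<forall>x\<in>P. ?d (gz_normal k) v \<le> ?d (gz_normal k) x)" for k
    by (rule polytope_linear_min[OF assms(3) ne linear_dot_right])
  \<comment> \<open>The minimizers are chosen as vertices so that \<open>h\<close> is integral for a
    lattice polytope.\<close>
  then obtain v where v: "\<And>k. v k extreme_point_of P"
    "\<And>k x. x \<in> P \<Longrightarrow> ?d (gz_normal k) (v k) \<le> ?d (gz_normal k) x" by metis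
  have vP: "v k \<in> P" for k using v(1) by (simp add: extreme_point_of_def)
  define h where "h k = ?d (gz_normal k) (v k)" for k

  \<comment> \<open>The active normals lie in a common cone of the fan of \<open>P\<close>, hence
    are minimized by a common point.\<close>
  have cone: "\<exists>f\<in>P. \<forall>k\<in>gz_active n real x. ?d (gz_normal k) f = h k"
    if x: "x \<in> gz_polytope n real" for x
  proof -
    obtain f where f: "f \<in> P"
      "\<And>u y. u \<in> gz_active_cone n (gz_active n real x) \<Longrightarrow> y \<in> P \<Longrightarrow> ?d u f \<le> ?d u y"
      using normal_fan_minimizer[of "gz_active_cone n (gz_active n real x)" ?I P] fan x by blast
    have "?d (gz_normal k) f = h k" if "k \<in> gz_active n real x" for k
      unfolding h_def using f(2)[OF gz_normal_in_gz_active_cone[OF active that] vP] v(2)[OF f(1), of k]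
      by (intro antisym)
    with f(1) show ?thesis by blast
  qed

  have P_iff: "y \<in> P \<longleftrightarrow> y \<in> coord_space ?I \<and> (\<forall>k\<in>?K. ?s k y \<ge> h k)" for y
  proof
    assume "y \<in> P"
    then show "y \<in> coord_space ?I \<and> (\<forall>k\<in>?K. ?s k y \<ge> h k)"
      using assms(2) v(2) unfolding h_def by (auto simp del: split_paired_All simp flip: dot_gz_normal)
  next
    assume y: "y \<in> coord_space ?I \<and> (\<forall>k\<in>?K. ?s k y \<ge> h k)"
    show "y \<in> P"
    proof (rule ccontr)
      assume "y \<notin> P"
      then obtain u where u: "u \<in> coord_space ?I" "\<And>x. x \<in> P \<Longrightarrow> ?d u y < ?d u x"
        using polytope_separation[OF finite_gz_index assms(3,2)] y by blast
      obtain x where x: "x \<in> gz_polytope n real" "u \<in> gz_active_cone n (gz_active n real x)"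
        using normal_fan_covers[OF assms(3) ne u(1)] fan by auto
      obtain f where f: "f \<in> P" "\<And>k. k \<in> gz_active n real x \<Longrightarrow> ?d (gz_normal k) f = h k"
        using cone[OF x(1)] by blast
      obtain t where t: "\<And>k. k \<in> gz_active n real x \<Longrightarrow> t k \<ge> 0"
        "\<And>v. ?d u v = (\<Sum>k\<in>gz_active n real x. t k * ?d (gz_normal k) v)"
        using gz_active_cone_generated[OF active x(2)] by blast
      \<comment> \<open>\<open>u\<close> is a nonnegative combination of active normals, whose
        inequalities are tight at \<open>f\<close> and valid at \<open>y\<close>. This contradicts
        the separation.\<close>
      have "?d u f \<le> ?d u y"
        unfolding t(2)
      proof (intro sum_mono mult_left_mono t(1))
        fix k assume k: "k \<in> gz_active n real x"
        then have "k \<in> ?K" using active by blast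
        with y f(2)[OF k] show "?d (gz_normal k) f \<le> ?d (gz_normal k) y"
          by (simp add: dot_gz_normal del: split_paired_All split_paired_Ball_Sigma)
      qed
      with u(2)[OF f(1)] show False by simp
    qed
  qed

  have diamond: "h (False, i, j) + h (True, i, j + 1) = h (True, i + 1, j) + h (False, i + 1, j)"
    if i: "i \<ge> 1" and ij: "(i + 1, j) \<in> ?I" for i j
  proof -
    obtain x where x: "x \<in> gz_polytope n real"
      "{(True, i + 1, j), (False, i + 1, j), (False, i, j), (True, i, j + 1)} \<subseteq> gz_active n real x"
      using gz_diamond_active[OF i, of n j] ij by auto
    obtain f where f: "\<And>k. k \<in> gz_active n real x \<Longrightarrow> ?d (gz_normal k) f = h k"
      using cone[OF x(1)] by blast
    have "?d (gz_normal (False, i, j) + gz_normal (True, i, j + 1)) f =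
        ?d (gz_normal (True, i + 1, j) + gz_normal (False, i + 1, j)) f"
      by (simp only: gz_normal_diamond[OF i])
    then show ?thesis
      using x(2) by (simp only: linear_add[OF linear_dot_left] f insert_subset)
  qed

  define \<phi> where "\<phi> = gz_potential h"
  \<comment> \<open>Subtracting \<open>\<phi>\<close> from the whole array, whose row 0 is zero for
    the linear slacks, leaves \<open>-\<phi>\<close> in row 0; \<open>c\<close> holds the other
    rows.\<close>
  define lam where "lam j = - \<phi> 0 j" for j
  obtain c where c: "c \<in> coord_space ?I"
    "\<And>p. p \<in> ?I \<Longrightarrow> Poly_Mapping.lookup c p = \<phi> (fst p) (snd p)"
    using coord_space_exists[OF finite_gz_index, of n "\<lambda>p. \<phi> (fst p) (snd p)"] by blast
  have slack: "gz_slack lam k (x - c) = ?s k x - h k" if k: "k \<in> ?K" for k x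
  proof -
    obtain b i j where bij: "k = (b, i, j)" "(i, j) \<in> ?I" using k by auto
    have e: "gz_entry lam (x - c) i j = gz_entry (\<lambda>_. 0) x i j - \<phi> i j"
      if "i = 0 \<or> (i, j) \<in> ?I" for i j
      using that c(2)[of "(i, j)"] by (auto simp: gz_entry_def lam_def lookup_minus)
    have "i \<ge> 1" "j \<ge> 1" using bij(2) by (auto simp: gz_index_def)
    then show ?thesis
      using gz_potential_lower[OF diamond bij(2)] gz_potential_upper[of i j h]
        e[of i j] e[OF gz_index_above(1)[OF bij(2)]] e[OF gz_index_above(2)[OF bij(2)]] bij(2)
      unfolding bij(1) gz_slack_def \<phi>_def[symmetric] by auto
  qed
  have shift: "x \<in> P \<longleftrightarrow> x - c \<in> gz_polytope n lam" for x
  proof -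
    have "x - c \<in> coord_space ?I \<longleftrightarrow> x \<in> coord_space ?I"
      using c(1) by (simp add: coord_space_iff lookup_minus)
    then show ?thesis
      unfolding P_iff gz_polytope_iff by (simp add: slack)
  qed
  have eq: "P = (+) c ` gz_polytope n lam"
  proof (intro set_eqI iffI)
    fix x assume "x \<in> P"
    then show "x \<in> (+) c ` gz_polytope n lam"
      using shift by (intro image_eqI[of _ _ "x - c"]) auto
  qed (auto simp: shift)

  \<comment> \<open>Any point of the polytope squeezes its first row between consecutive
    \<open>lam j\<close>, which forces \<open>lam\<close> to increase.\<close>
  obtain x where x: "x \<in> gz_polytope n lam" using ne eq by blast
  have lam_step: "lam j \<le> lam (j + 1)" if "1 \<le> j" "j + 1 \<le> n" for j
  proof -
    have "(1, j) \<in> ?I" using that by (auto simp: gz_index_def)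
    then show ?thesis using x by (force simp: gz_polytope_def gz_entry_def)
  qed
  have "lam i \<le> lam j" if "1 \<le> i" "i \<le> j" "j \<le> n" for i j
    using that(2,3)
  proof (induction j rule: dec_induct)
    case (step m)
    then show ?case using that(1) lam_step[of m] by simp
  qed simp
  then have inc: "increasing_seq n lam"
    by (auto simp: increasing_seq_def mono_on_def)

  \<comment> \<open>Integrality for lattice polytopes\<close>
  have "dominant_weight n lam \<and> c \<in> lattice_points" if L: "lattice_polytope P"
  proof -
    have "h k \<in> \<int>" if "k \<in> ?K" for k
    proof -
      have "v k \<in> lattice_points"
        using L v(1) by (simp add: lattice_polytope_def)
      then have "?s k (v k) \<in> \<int>"
        by (auto simp: gz_slack_def gz_entry_def lattice_points_def split: prod.splits)
      then show ?thesis using dot_gz_normal[OF that] by (simp add: h_def)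
    qed
    then have int: "\<phi> i j \<in> \<int>" if "j \<ge> 1" "i + j \<le> n" for i j
      unfolding \<phi>_def using that by (rule gz_potential_Ints)
    have "Poly_Mapping.lookup c (i, j) \<in> \<int>" for i j
    proof (cases "(i, j) \<in> ?I")
      case True
      then show ?thesis using c(2)[OF True] int[of j i] by (auto simp: gz_index_def)
    next
      case False
      then show ?thesis using c(1) by (simp add: coord_space_iff)
    qed
    then show ?thesis
      using inc int by (auto simp: dominant_weight_def lattice_points_def lam_def)
  qed
  with inc c(1) eq show ?thesis by blast
qed

end
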